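(* Let $W\subset S^1$ with $|W|=4$ satisfy condition $T'(W)$: $(W+\tfrac ik)\cap W=\emptyset$ for $k\in\{4,5\}$ and all $i$ with $1\le i\le k-1$, $\gcd(i,k)=1$. Then $P(W)$ holds.
   Context: Identify $S^1$ with $\mathbb{R}/\mathbb{Z}$. The group $O(2)$ acts on $S^1$ by translations $\sigma_a(x)=x+a$ and reflections $\tau_a(x)=-x+2a$. A coloring $c:S^1\to\{R,B\}$ is distinguishing if no non-identity $\gamma\in O(2)$ satisfies $c\circ\gamma=c$. For $W\subset S^1$ with trivial pointwise stabilizer in $O(2)$, $P(W)$ holds if every precoloring $c:S^1\setminus W\to\{R,B\}$ extends to a distinguishing coloring of $S^1$. *)

theory Defs
  imports Complex_Main
begin

text \<open>The circle S^1 = R/Z is represented by the canonical representatives [0,1);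
  a point x of R is sent to its class frac x.\<close>

definition circle :: "real set" where
  "circle = {0..<1}"

datatype color = R | B

definition transl :: "real \<Rightarrow> real \<Rightarrow> real" where
  "transl a x = frac (x + a)"

definition refl :: "real \<Rightarrow> real \<Rightarrow> real" where
  "refl a x = frac (- x + 2 * a)"

definition O2 :: "(real \<Rightarrow> real) set" where
  "O2 = {transl a | a. a \<in> circle} \<union> {refl a | a. a \<in> circle}"

definition is_identity :: "(real \<Rightarrow> real) \<Rightarrow> bool" where
  "is_identity g \<longleftrightarrow> (\<forall>x\<in>circle. g x = x)"

definition distinguishing :: "(real \<Rightarrow> color) \<Rightarrow> bool" where
  "distinguishing c \<longleftrightarrow>
     (\<forall>g\<in>O2. (\<forall>x\<in>circle. c (g x) = c x) \<longrightarrow> is_identity g)"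

definition P :: "real set \<Rightarrow> bool" where
  "P W \<longleftrightarrow> (\<forall>c0 :: real \<Rightarrow> color. \<exists>c. distinguishing c \<and>
              (\<forall>x\<in>circle - W. c x = c0 x))"

definition shift_set :: "real set \<Rightarrow> real \<Rightarrow> real set" where
  "shift_set W t = (\<lambda>w. frac (w + t)) ` W"

definition T' :: "real set \<Rightarrow> bool" where
  "T' W \<longleftrightarrow> (\<forall>k::nat\<in>{4,5}. \<forall>i::nat. 1 \<le> i \<and> i \<le> k - 1 \<and> gcd i k = 1 \<longrightarrow>
              shift_set W (real i / real k) \<inter> W = {})"

end

theory Submission
  imports Defs
begin

text \<open>Suppose every recoloring of \<open>W\<close> leaves a symmetric coloring, and write colorings as
  functions \<open>f\<close> to \<open>bool\<close> on the group \<open>R/Z\<close>.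

  If some such \<open>f\<close> becomes \<open>a\<close>-periodic after changing at most one point, with \<open>a\<close> of order at least 4,
  then a symmetry of a coloring obtained by changing at most three points of the periodic one must
  already be a symmetry of the set of changed points. Three points are symmetric only if they form
  an arithmetic progression, and \<open>T'\<close> provides three admissible points that do not. Periods of order
  2 and 3 are destroyed by recoloring two points of \<open>W\<close> against their antipodes and the other two
  against a point of their equilateral triangle.

  So some \<open>f\<close> is not within one point of a periodic coloring. It has a reflection \<open>x \<mapsto> r - x\<close>, and
  flipping \<open>u \<in> W\<close> yields a reflection \<open>x \<mapsto> r + s - x\<close>. If \<open>s \<noteq> 0\<close>, translation by \<open>s\<close> changes \<open>f\<close> at
  exactly two points. Two such translations are so rigid that \<open>W\<close> is confined to the centers of the
  reflection and four points determined by \<open>u\<close>. The same applies to \<open>f\<close> flipped at \<open>u\<close>; together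
  this makes \<open>W\<close> a four-term progression with difference \<open>s\<close>, and then some recoloring of \<open>W\<close> is
  \<open>s\<close>-periodic after all.\<close>

section \<open>The circle group\<close>

text \<open>A type rather than the set \<open>circle\<close>, so that addition modulo 1 becomes an
  \<open>ab_group_add\<close> and group identities can be left to simplification.\<close>

typedef circ = "{0..<1::real}" morphisms rep abs_circ
  by (rule exI[of _ 0]) simp

definition pt :: "real \<Rightarrow> circ" where
  "pt x = abs_circ (frac x)"

lemma rep_bounds: "0 \<le> rep p" "rep p < 1"
  using rep[of p] by auto

lemma rep_pt [simp]: "rep (pt x) = frac x"
  by (simp add: pt_def abs_circ_inverse frac_lt_1)

lemma pt_rep [simp]: "pt (rep p) = p"
  using rep_bounds[of p] by (simp add: pt_def rep_inverse)

lemma pt_eq_iff: "pt x = pt y \<longleftrightarrow> x - y \<in> \<int>"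
proof -
  have "pt x = pt y \<longleftrightarrow> frac x = frac y"
    by (metis rep_pt pt_def)
  also have "\<dots> \<longleftrightarrow> x - y \<in> \<int>"
    by (metis Ints_of_int add_diff_cancel_left' diff_add_cancel frac_add_int_left frac_eqE frac_eq_0_iff frac_diff_eq)
  finally show ?thesis .
qed

lemma pt_cases: obtains x where "p = pt x" "0 \<le> x" "x < 1"
  using rep_bounds[of p] pt_rep[of p] by metis

lemma frac_frac_diff: "frac (frac x - y) = frac (x - y)"
  using frac_add_simps(1)[of x "- y"] by simp

instantiation circ :: ab_group_add
begin

definition "0 = pt 0"
definition "p + q = pt (rep p + rep q)"
definition "- p = pt (- rep p)"
definition "(p::circ) - q = pt (rep p - rep q)"

instance
  by standard
     (auto simp: zero_circ_def plus_circ_def uminus_circ_def minus_circ_def frac_neg_frac add_ac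
       simp flip: rep_inject)

end

lemma pt_add: "pt x + pt y = pt (x + y)"
  and pt_minus: "- pt x = pt (- x)"
  and pt_diff: "pt x - pt y = pt (x - y)"
  and pt_0: "0 = pt 0"
  by (auto simp: zero_circ_def plus_circ_def uminus_circ_def minus_circ_def frac_neg_frac
      frac_diff_simp frac_frac_diff simp flip: rep_inject)

lemmas pt_simps = pt_add pt_minus pt_diff pt_0 pt_eq_iff

text \<open>Turns a congruence modulo 1 into a real equation, once the size of the representatives
  leaves a single candidate integer.\<close>

lemma Ints_between:
  assumes "z \<in> \<int>" "of_int n - 1 < z" "z < of_int n + (1::real)"
  shows "z = of_int n"
  using assms by (elim Ints_cases) auto

lemma half_unique:
  fixes a :: circ
  assumes "a + a = 0" "a \<noteq> 0"
  shows "a = pt (1/2)"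
proof -
  obtain x where x: "a = pt x" "0 \<le> x" "x < 1" by (rule pt_cases)
  have "x + x \<in> \<int>" "x \<noteq> 0" using assms x(1) by (auto simp: pt_simps)
  then have "x + x = of_int 1" using x by (intro Ints_between) auto
  then have "x = 1/2" by simp
  then show ?thesis using x(1) by blast
qed

lemma third_unique:
  fixes a :: circ
  assumes "a + a + a = 0" "a \<noteq> 0"
  shows "a = pt (1/3) \<or> a = - pt (1/3)"
proof -
  obtain x where x: "a = pt x" "0 \<le> x" "x < 1" by (rule pt_cases)
  have i: "x + x + x \<in> \<int>" "x \<noteq> 0" using assms x(1) by (auto simp: pt_simps)
  have "x + x + x = of_int 1 \<or> x + x + x = of_int 2"
    using Ints_between[of "x + x + x" 1] Ints_between[of "x + x + x" 2] i x by (cases "x + x + x < 2") auto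
  then have "x = 1/3 \<or> x = 2/3" by auto
  moreover have "- pt (1/3) = pt (2/3)" by (simp add: pt_simps)
  ultimately show ?thesis using x(1) by metis
qed

text \<open>Stated up to sign because \<open>avoids_gaps\<close> tests each difference in both
  orders.\<close>

lemma fifth_cases:
  fixes a :: circ
  assumes "a + a + a + a + a = 0" "a \<noteq> 0"
  shows "a \<in> {pt (1/5), pt (2/5)} \<or> - a \<in> {pt (1/5), pt (2/5)}"
proof -
  obtain x where x: "a = pt x" "0 \<le> x" "x < 1" by (rule pt_cases)
  have i: "x + x + x + x + x \<in> \<int>" "x \<noteq> 0" using assms x(1) by (auto simp: pt_simps)
  then obtain n :: int where n: "x + x + x + x + x = of_int n" by (auto elim: Ints_cases)
  then have "0 < n" "n < 5" using x i(2) by linarith+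
  then have "n = 1 \<or> n = 2 \<or> n = 3 \<or> n = 4" by auto
  then have "x = 1/5 \<or> x = 2/5 \<or> x = 3/5 \<or> x = 4/5" using n by auto
  moreover have "- pt (3/5) = pt (2/5)" "- pt (4/5) = pt (1/5)" by (simp_all add: pt_simps)
  ultimately show ?thesis using x(1) by (metis insertCI)
qed

text \<open>The kernel of doubling has order two, so a reflection fixes at most two points.\<close>

lemma at_most_two_halves:
  fixes p q s :: circ
  assumes "p + p = q + q" "q + q = s + s"
  shows "p = q \<or> q = s \<or> p = s"
proof -
  have "(p - q) + (p - q) = 0" "(q - s) + (q - s) = 0" using assms by (simp_all add: algebra_simps)
  then have "p = q \<or> q = s \<or> p - q = q - s" using half_unique by (metis eq_iff_diff_eq_0)
  moreover have "p = s" if "p - q = q - s" using that assms by (simp add: algebra_simps)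
  ultimately show ?thesis by blast
qed

section \<open>Three-term progressions and forbidden gaps\<close>

definition progression :: "'a::ab_group_add \<Rightarrow> 'a \<Rightarrow> 'a \<Rightarrow> bool" where
  "progression p q s \<longleftrightarrow> p + p = q + s \<or> q + q = p + s \<or> s + s = p + q"

lemma progression_translate: "progression (z + p) (z + q) (z + s) = progression p q s"
proof -
  have "(z + a) + (z + b) = (z + c) + (z + d) \<longleftrightarrow> a + b = c + d" for a b c d
    by (simp add: algebra_simps)
  then show ?thesis by (simp add: progression_def)
qed

text \<open>Each congruence puts an integer in an open interval of length two with integer ends, so
  the integer is the midpoint.\<close>

lemma progression_zero_real:
  assumes "0 < x" "x < y" "y < 1" "progression (pt x) (pt y) 0"
  shows "x + y = 1 \<or> y = 2 * x \<or> 2 * y = 1 + x"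
proof -
  have "x + x - y \<in> \<int> \<or> y + y - x \<in> \<int> \<or> 0 - (x + y) \<in> \<int>"
    using assms(4) by (simp add: progression_def pt_simps)
  then show ?thesis
    using assms(1-3) Ints_between[of "x + x - y" 0] Ints_between[of "y + y - x" 1] Ints_between[of "0 - (x + y)" "-1"]
    by auto
qed

lemma progression_real:
  assumes "0 < x" "x < y" "y < z" "z < 1" "progression (pt x) (pt y) (pt z)"
  shows "2 * x = y + z - 1 \<or> 2 * y = x + z \<or> 2 * z = x + y + 1"
proof -
  have "x + x - (y + z) \<in> \<int> \<or> y + y - (x + z) \<in> \<int> \<or> z + z - (x + y) \<in> \<int>"
    using assms(5) by (simp add: progression_def pt_simps)
  then show ?thesis
    using assms(1-4) Ints_between[of "x + x - (y + z)" "-1"] Ints_between[of "y + y - (x + z)" 0]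
      Ints_between[of "z + z - (x + y)" 1]
    by auto
qed

lemma sorted_four:
  fixes X :: "'a::linorder set"
  assumes "card X = 4"
  obtains x y z w where "X = {x, y, z, w}" "x < y" "y < z" "z < w"
proof -
  define l where "l = sorted_list_of_set X"
  have "finite X" using assms card.infinite by force
  then have l: "set l = X" "sorted_wrt (<) l" "length l = 4"
    using assms by (simp_all add: l_def)
  then obtain x y z w where "l = [x, y, z, w]"
    by (auto simp: numeral_eq_Suc length_Suc_conv)
  then show thesis using l that by auto
qed

text \<open>The remaining differences excluded by \<open>T'\<close> are the negatives of these three.\<close>

definition avoids_gaps :: "circ set \<Rightarrow> bool" where
  "avoids_gaps W \<longleftrightarrow> (\<forall>p\<in>W. \<forall>q\<in>W. p - q \<notin> {pt (1/4), pt (1/5), pt (2/5)})"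

text \<open>Measuring from \<open>c\<close> and sorting turns progressions into linear equations
  between ordered reals.\<close>

lemma rotated_coordinates:
  fixes W :: "circ set"
  assumes "card W = 4"
  obtains x y z w where "W = {c + pt x, c + pt y, c + pt z, c + pt w}"
    "0 \<le> x" "x < y" "y < z" "z < w" "w < 1"
proof -
  let ?h = "\<lambda>p. rep (p - c)"
  have inj: "inj_on ?h W" by (auto simp: inj_on_def rep_inject)
  then have "card (?h ` W) = 4" using assms by (simp add: card_image)
  then obtain x y z w where X: "?h ` W = {x, y, z, w}" "x < y" "y < z" "z < w"
    by (rule sorted_four)
  have "W = (\<lambda>p. c + pt (?h p)) ` W" by simp
  also have "\<dots> = (\<lambda>x. c + pt x) ` (?h ` W)" by (simp only: image_image)
  finally have "W = {c + pt x, c + pt y, c + pt z, c + pt w}" unfolding X by simp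
  moreover have "x \<in> ?h ` W" "w \<in> ?h ` W" using X by auto
  then have "0 \<le> x" "w < 1" using rep_bounds by auto
  ultimately show thesis using X that by blast
qed

lemma pt_inj: "0 \<le> x \<Longrightarrow> x < y \<Longrightarrow> y < 1 \<Longrightarrow> pt x \<noteq> pt y"
  using Ints_between[of "x - y" 0] by (auto simp: pt_eq_iff)

text \<open>Take a point of \<open>W\<close> as origin. If all four triples were progressions, the
  resulting linear systems would force the first nonzero coordinate to be 1/4, 1/5 or 2/5, a
  forbidden gap. Squares and four vertices of a regular pentagon are genuine exceptions.\<close>

lemma exists_non_progression:
  assumes "card W = 4" "avoids_gaps W"
  obtains p q s where "p \<in> W" "q \<in> W" "s \<in> W" "p \<noteq> q" "p \<noteq> s" "q \<noteq> s" "\<not> progression p q s"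
proof -
  obtain c where c: "c \<in> W" using assms(1) by fastforce
  obtain o' x y z where W: "W = {c + pt o', c + pt x, c + pt y, c + pt z}"
    and o: "0 \<le> o'" "o' < x" "x < y" "y < z" "z < 1"
    using rotated_coordinates[OF assms(1)] by metis
  have "o' = 0"
  proof (rule ccontr)
    assume "o' \<noteq> 0"
    then have "pt 0 \<noteq> pt o'" "pt 0 \<noteq> pt x" "pt 0 \<noteq> pt y" "pt 0 \<noteq> pt z"
      using o pt_inj[of 0 o'] pt_inj[of 0 x] pt_inj[of 0 y] pt_inj[of 0 z] by linarith+
    then show False using c unfolding W by (auto simp: pt_0)
  qed
  then have W': "c + 0 \<in> W" "c + pt x \<in> W" "c + pt y \<in> W" "c + pt z \<in> W"
    using W by (auto simp: pt_0)
  have d: "pt x \<noteq> 0" "pt y \<noteq> 0" "pt z \<noteq> 0" "pt x \<noteq> pt y" "pt x \<noteq> pt z" "pt y \<noteq> pt z"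
    using o pt_inj[of 0 x] pt_inj[of 0 y] pt_inj[of 0 z] pt_inj[of x y] pt_inj[of x z] pt_inj[of y z]
    by (auto simp: pt_0)
  have "c + pt x - (c + 0) \<notin> {pt (1/4), pt (1/5), pt (2/5)}"
    using assms(2) W' unfolding avoids_gaps_def by blast
  then have "pt x \<noteq> pt (1/4)" "pt x \<noteq> pt (1/5)" "pt x \<noteq> pt (2/5)" by simp_all
  then have nx: "x \<noteq> 1/4 \<and> x \<noteq> 1/5 \<and> x \<noteq> 2/5" by blast
  have "\<not> (progression (pt x) (pt y) 0 \<and> progression (pt x) (pt z) 0 \<and> progression (pt y) (pt z) 0
    \<and> progression (pt x) (pt y) (pt z))"
  proof
    assume pr: "progression (pt x) (pt y) 0 \<and> progression (pt x) (pt z) 0 \<and> progression (pt y) (pt z) 0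
      \<and> progression (pt x) (pt y) (pt z)"
    have "x + y = 1 \<or> y = 2 * x \<or> 2 * y = 1 + x" "x + z = 1 \<or> z = 2 * x \<or> 2 * z = 1 + x"
      and r: "y + z = 1 \<or> z = 2 * y \<or> 2 * z = 1 + y" "2 * x = y + z - 1 \<or> 2 * y = x + z \<or> 2 * z = x + y + 1"
      using pr o progression_zero_real[of x y] progression_zero_real[of x z] progression_zero_real[of y z]
        progression_real[of x y z] by auto
    then have "x = 1/4 \<or> x = 1/5 \<or> x = 2/5"
      apply (elim disjE) using o r by linarith+
    with nx show False by blast
  qed
  then show thesis
    using that[of "c + pt x" "c + pt y" "c + 0"] that[of "c + pt x" "c + pt z" "c + 0"]
      that[of "c + pt y" "c + pt z" "c + 0"] that[of "c + pt x" "c + pt y" "c + pt z"] W' d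
    by (simp only: progression_translate add_left_cancel) blast
qed

text \<open>If every pair formed a progression with \<open>c\<close>, the linear systems would be
  inconsistent unless the first gap is 1/5, as it is when \<open>W\<close> and \<open>c\<close> form
  a regular pentagon.\<close>

lemma exists_non_progression_through:
  assumes "card W = 4" "avoids_gaps W" "c \<notin> W"
  obtains p q where "p \<in> W" "q \<in> W" "p \<noteq> q" "p \<noteq> c" "q \<noteq> c" "\<not> progression p q c"
proof -
  obtain x y z w where W: "W = {c + pt x, c + pt y, c + pt z, c + pt w}"
    and o': "0 \<le> x" "x < y" "y < z" "z < w" "w < 1"
    using rotated_coordinates[OF assms(1)] by metis
  have "x \<noteq> 0" using assms(3) W by (auto simp: pt_0[symmetric])
  then have o: "0 < x" "x < y" "y < z" "z < w" "w < 1" using o' by auto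
  have W': "c + pt x \<in> W" "c + pt y \<in> W" "c + pt z \<in> W" "c + pt w \<in> W"
    using W by auto
  have "c + pt y - (c + pt x) \<notin> {pt (1/4), pt (1/5), pt (2/5)}"
    using assms(2) W' unfolding avoids_gaps_def by blast
  then have "pt (y - x) \<noteq> pt (1/5)" by (simp add: pt_diff)
  then have nx: "y - x \<noteq> 1/5" by metis
  have "\<exists>a\<in>{x,y,z,w}. \<exists>b\<in>{x,y,z,w}. a < b \<and> \<not> progression (pt a) (pt b) 0"
  proof (rule ccontr)
    assume "\<not> ?thesis"
    then have "a + b = 1 \<or> b = 2 * a \<or> 2 * b = 1 + a" if "a \<in> {x,y,z,w}" "b \<in> {x,y,z,w}" "a < b" for a b
      using that o progression_zero_real[of a b] by auto
    then have "x + y = 1 \<or> y = 2 * x \<or> 2 * y = 1 + x" "x + z = 1 \<or> z = 2 * x \<or> 2 * z = 1 + x"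
        "x + w = 1 \<or> w = 2 * x \<or> 2 * w = 1 + x"
      and r: "y + z = 1 \<or> z = 2 * y \<or> 2 * z = 1 + y" "y + w = 1 \<or> w = 2 * y \<or> 2 * w = 1 + y"
        "z + w = 1 \<or> w = 2 * z \<or> 2 * w = 1 + z"
      using o by simp_all
    then show False
      apply (elim disjE) using o r nx by linarith+
  qed
  then obtain a b where ab: "a \<in> {x,y,z,w}" "b \<in> {x,y,z,w}" "a < b" "\<not> progression (pt a) (pt b) 0"
    by blast
  have "c + pt a \<in> W" "c + pt b \<in> W" using ab W by auto
  moreover have "pt a \<noteq> pt b" using ab o by (intro pt_inj) auto
  moreover have "\<not> progression (c + pt a) (c + pt b) c"
    using ab(4) progression_translate[of c "pt a" "pt b" 0] by simp
  ultimately show thesis using that assms(3) by (metis add_left_cancel)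
qed

section \<open>Symmetries of colorings\<close>

definition periodic :: "('a::ab_group_add \<Rightarrow> bool) \<Rightarrow> 'a \<Rightarrow> bool" where
  "periodic f a \<longleftrightarrow> (\<forall>x. f (x + a) = f x)"

text \<open>The parameter is the sum of a point and its image, not the center, so composing two
  reflections requires no halving.\<close>

definition reflective :: "('a::ab_group_add \<Rightarrow> bool) \<Rightarrow> 'a \<Rightarrow> bool" where
  "reflective f r \<longleftrightarrow> (\<forall>x. f (r - x) = f x)"

definition rigid :: "('a::ab_group_add \<Rightarrow> bool) \<Rightarrow> bool" where
  "rigid f \<longleftrightarrow> (\<forall>r. \<not> reflective f r) \<and> (\<forall>a. a \<noteq> 0 \<longrightarrow> \<not> periodic f a)"

text \<open>The negation of the goal for the precoloring \<open>f\<close>. Values of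
  \<open>f\<close> on \<open>W\<close> are immaterial, so \<open>f\<close> may be recolored there at
  will.\<close>

definition unbreakable :: "'a::ab_group_add set \<Rightarrow> ('a \<Rightarrow> bool) \<Rightarrow> bool" where
  "unbreakable W f \<longleftrightarrow> (\<forall>g. (\<forall>x. x \<notin> W \<longrightarrow> g x = f x) \<longrightarrow> \<not> rigid g)"

definition flip :: "('a \<Rightarrow> bool) \<Rightarrow> 'a \<Rightarrow> 'a \<Rightarrow> bool" where
  "flip f u = f(u := \<not> f u)"

definition strongly_aperiodic :: "('a::ab_group_add \<Rightarrow> bool) \<Rightarrow> bool" where
  "strongly_aperiodic f \<longleftrightarrow>
     (\<forall>a. a \<noteq> 0 \<longrightarrow> \<not> periodic f a \<and> (\<forall>z. \<not> periodic (flip f z) a))"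

text \<open>What remains of a reflection \<open>r\<close> of \<open>f\<close> and a reflection
  \<open>r + s\<close> of \<open>flip f u\<close>: their composite, translation by \<open>s\<close>,
  changes colors only at \<open>r - u\<close> and \<open>u - s\<close>. The three inequalities on
  \<open>u + u\<close> say that these two points are distinct and not \<open>s\<close>
  apart.\<close>

definition step :: "('a::ab_group_add \<Rightarrow> bool) \<Rightarrow> 'a \<Rightarrow> 'a \<Rightarrow> 'a \<Rightarrow> bool" where
  "step f r u s \<longleftrightarrow> s \<noteq> 0 \<and> s + s \<noteq> 0 \<and> u + u \<noteq> r \<and> u + u \<noteq> r + s \<and> u + u \<noteq> r + s + s \<and>
     (\<forall>x. f (x + s) \<noteq> f x \<longleftrightarrow> x = r - u \<or> x = u - s)"

lemma flip_apply: "flip f u x = (f x \<noteq> (x = u))"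
  by (auto simp: flip_def)

lemma flip_flip [simp]: "flip (flip f u) u = f"
  by (auto simp: flip_apply fun_eq_iff)

lemma unbreakable_agree:
  "unbreakable W f \<Longrightarrow> (\<And>x. x \<notin> W \<Longrightarrow> g x = f x) \<Longrightarrow> unbreakable W g"
  unfolding unbreakable_def by auto

lemma unbreakable_flip: "unbreakable W f \<Longrightarrow> u \<in> W \<Longrightarrow> unbreakable W (flip f u)"
  by (erule unbreakable_agree) (auto simp: flip_apply)

lemma unbreakable_not_rigid: "unbreakable W f \<Longrightarrow> \<not> rigid f"
  unfolding unbreakable_def by auto

text \<open>If \<open>g\<close> and \<open>g \<circ> \<phi>\<close> differ on \<open>X\<close>, then \<open>X\<close> and \<open>\<phi> ` X\<close> are disjoint and every
  \<open>x \<in> X\<close> has exactly one of \<open>x\<close>, \<open>\<phi> x\<close> in \<open>F\<close>, so \<open>X\<close> injects into \<open>F\<close>.\<close>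

lemma invariant_of_small_perturbation:
  assumes "finite F" "card F < card X" "inj \<phi>"
    and g: "\<And>x. x \<in> X \<Longrightarrow> g x = c" and g\<phi>: "\<And>x. x \<in> X \<Longrightarrow> g (\<phi> x) = d"
    and inv: "\<And>x. (g (\<phi> x) \<noteq> (\<phi> x \<in> F)) = (g x \<noteq> (x \<in> F))"
  shows "c = (d::bool)"
proof (rule ccontr)
  assume ne: "c \<noteq> d"
  let ?h = "\<lambda>x. if x \<in> F then x else \<phi> x"
  have dis: "\<phi> x \<noteq> y" if "x \<in> X" "y \<in> X" for x y
    using that g g\<phi> ne by metis
  have "inj_on ?h X"
    using dis \<open>inj \<phi>\<close> by (auto simp: inj_on_def)
  moreover have "?h x \<in> F" if "x \<in> X" for x
    using g[OF that] g\<phi>[OF that] inv[of x] ne by auto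
  then have "?h ` X \<subseteq> F" by blast
  ultimately show False
    using card_inj_on_le[of ?h X F] assms(1,2) by simp
qed

lemma card_four_translates:
  fixes a :: "'a::ab_group_add"
  assumes "a \<noteq> 0" "a + a \<noteq> 0" "a + a + a \<noteq> 0"
  shows "card {x, x + a, x + a + a, x + a + a + a} = 4"
proof -
  have "x + a \<noteq> x + a + a + a" "x \<noteq> x + a + a" "x \<noteq> x + a + a + a"
    using assms by (metis add.assoc add_cancel_left_right)+
  then show ?thesis
    using assms by (auto simp: card_insert_if)
qed

lemma periodic_diff: "periodic f a \<Longrightarrow> f (x - a) = f x"
  unfolding periodic_def by (metis diff_add_cancel)

text \<open>Both \<open>g\<close> and its image under a symmetry of the perturbed coloring are
  constant on four \<open>a\<close>-translates, which outnumber the three flipped points. So the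
  symmetry preserves \<open>g\<close>, hence the set of flipped points.\<close>

lemma progression_of_invariant:
  fixes p q s :: circ
  assumes per: "periodic g a" and a: "a \<noteq> 0" "a + a \<noteq> 0" "a + a + a \<noteq> 0"
    and dist: "p \<noteq> q" "p \<noteq> s" "q \<noteq> s"
    and nr: "\<not> rigid (flip (flip (flip g p) q) s)"
  shows "progression p q s"
proof -
  let ?F = "{p, q, s}"
  have fl: "flip (flip (flip g p) q) s x = (g x \<noteq> (x \<in> ?F))" for x
    using dist by (auto simp: flip_apply)
  have g: "g (x + a) = g x" "g (x - a) = g x" for x
    using per by (auto simp: periodic_def periodic_diff)
  have cF: "card ?F < 4" using dist by auto
  \<comment> \<open>Translations and reflections are treated together: they carry a shift by
    \<open>a\<close> to a shift by \<open>a\<close> or \<open>- a\<close>.\<close>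
  have *: "\<phi> x \<in> ?F \<longleftrightarrow> x \<in> ?F"
    if "inj \<phi>" and inv: "\<And>x. flip (flip (flip g p) q) s (\<phi> x) = flip (flip (flip g p) q) s x"
      and \<phi>: "\<And>x. \<phi> (x + a) \<in> {\<phi> x + a, \<phi> x - a}" for \<phi> x
  proof -
    have e: "g (\<phi> (x + a)) = g (\<phi> x)" for x
      using \<phi>[of x] g[of "\<phi> x"] by (elim insertE emptyE) simp_all
    have "g x = g (\<phi> x)"
    proof (rule invariant_of_small_perturbation[where F = ?F and \<phi> = \<phi> and g = g])
      show "card ?F < card {x, x + a, x + a + a, x + a + a + a}"
        unfolding card_four_translates[OF a] by (rule cF)
      show "(g (\<phi> y) \<noteq> (\<phi> y \<in> ?F)) = (g y \<noteq> (y \<in> ?F))" for y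
        using inv[of y] unfolding fl .
      show "g y = g x" if "y \<in> {x, x + a, x + a + a, x + a + a + a}" for y
        using that g(1) by (elim insertE) simp_all
      show "g (\<phi> y) = g (\<phi> x)" if "y \<in> {x, x + a, x + a + a, x + a + a + a}" for y
        using that e by (elim insertE) simp_all
    qed (use that(1) in simp_all)
    then show ?thesis
      using inv[of x] unfolding fl by auto
  qed
  consider r where "reflective (flip (flip (flip g p) q) s) r"
    | b where "b \<noteq> 0" "periodic (flip (flip (flip g p) q) s) b"
    using nr by (auto simp: rigid_def)
  then show ?thesis
  proof cases
    case 1
    have "r - x \<in> ?F \<longleftrightarrow> x \<in> ?F" for x
      by (rule *) (use 1 in \<open>auto simp: inj_def reflective_def algebra_simps\<close>)
    then have "r - p \<in> ?F" "r - q \<in> ?F" "r - s \<in> ?F" by blast+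
    then have "r = p + p \<or> r = p + q \<or> r = p + s" "r = p + q \<or> r = q + q \<or> r = q + s"
      "r = p + s \<or> r = q + s \<or> r = s + s"
      by (auto simp: algebra_simps)
    \<comment> \<open>The reflection cannot fix all three points, so it fixes one and swaps the
      others.\<close>
    moreover have "\<not> (r = p + p \<and> r = q + q \<and> r = s + s)"
      using dist at_most_two_halves[of p q s] by metis
    moreover have "p + q \<noteq> p + s" "p + q \<noteq> q + s" "p + s \<noteq> q + s" "p + p \<noteq> p + q" "p + p \<noteq> p + s"
      "q + q \<noteq> p + q" "q + q \<noteq> q + s" "s + s \<noteq> p + s" "s + s \<noteq> q + s"
      using dist by (simp_all add: add.commute[of p q])
    ultimately show ?thesis
      unfolding progression_def by metis
  next
    case 2
    have "x + b \<in> ?F \<longleftrightarrow> x \<in> ?F" for x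
      by (rule *) (use 2 in \<open>auto simp: inj_def periodic_def algebra_simps\<close>)
    then have m: "p + b \<in> ?F" "q + b \<in> ?F" "s + b \<in> ?F" by blast+
    \<comment> \<open>A two-cycle would leave the third point without an image, so \<open>b\<close>
      permutes the three points cyclically.\<close>
    then consider "p + b = q" "q + b = p" | "p + b = q" "q + b = s" | "p + b = s" "s + b = p" | "p + b = s" "s + b = q"
      using 2(1) by auto
    then show ?thesis
    proof cases
      case 1
      then show ?thesis using m(3) 2(1) dist by auto
    next
      case 3
      then show ?thesis using m(2) 2(1) dist by auto
    next
      case 2
      then have "q + q = p + s" by (metis add.assoc add.commute)
      then show ?thesis by (simp add: progression_def)
    next
      case 4
      then have "s + s = p + q" by (metis add.assoc add.commute)
      then show ?thesis by (simp add: progression_def)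
    qed
  qed
qed

lemma periodic_not_unbreakable:
  fixes f :: "circ \<Rightarrow> bool"
  assumes "periodic f a" "a \<noteq> 0" "a + a \<noteq> 0" "a + a + a \<noteq> 0"
    and "p \<in> W" "q \<in> W" "s \<in> W" "p \<noteq> q" "p \<noteq> s" "q \<noteq> s" "\<not> progression p q s"
  shows "\<not> unbreakable W f"
proof
  assume "unbreakable W f"
  then have "unbreakable W (flip (flip (flip f p) q) s)"
    using assms(5-7) by (intro unbreakable_flip)
  then show False
    using progression_of_invariant[OF assms(1-4,8-10)] assms(11) unbreakable_not_rigid by blast
qed

text \<open>One of the three perturbations is spent at \<open>z\<close> on returning from the
  periodic coloring to \<open>f\<close>; only \<open>p\<close> and \<open>q\<close> are recolored in
  \<open>W\<close>.\<close>

lemma flip_periodic_not_unbreakable: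
  fixes f :: "circ \<Rightarrow> bool"
  assumes "periodic (flip f z) a" "a \<noteq> 0" "a + a \<noteq> 0" "a + a + a \<noteq> 0"
    and "p \<in> W" "q \<in> W" "p \<noteq> q" "p \<noteq> z" "q \<noteq> z" "\<not> progression p q z"
  shows "\<not> unbreakable W f"
proof
  assume "unbreakable W f"
  then have "\<not> rigid (flip (flip f p) q)"
    using assms(5,6) by (intro unbreakable_not_rigid[of W] unbreakable_flip)
  moreover have "flip (flip (flip (flip f z) p) q) z = flip (flip f p) q"
    by (auto simp: flip_apply fun_eq_iff)
  ultimately show False
    using progression_of_invariant[OF assms(1-4,7-9)] assms(10) by simp
qed

section \<open>Pairs of reflections and the translations they compose to\<close>

text \<open>Composing the reflections gives translation by \<open>r' - r\<close>, which preserves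
  colors except where \<open>u\<close> is involved. Every degenerate position of the two exceptional
  points yields a period after at most one flip.\<close>

lemma step_of_reflections:
  assumes f: "reflective f r" and fu: "reflective (flip f u) r'" and sa: "strongly_aperiodic f"
  shows "u + u = r \<or> (r' \<noteq> r \<and> step f r u (r' - r))"
proof (cases "r' = r")
  case True
  then have "u + u = r"
    using f fu unfolding reflective_def flip_apply by (metis add_diff_cancel_left' diff_eq_eq)
  then show ?thesis ..
next
  case False
  define s where "s = r' - r"
  have s: "s \<noteq> 0" "r' = r + s" using False by (auto simp: s_def)
  have np: "\<not> periodic f s" "\<And>z. \<not> periodic (flip f z) s"
    using sa s(1) by (auto simp: strongly_aperiodic_def)
  have f': "f (r - x) = f x" for x using f by (simp add: reflective_def)
  have ch: "f (x + s) \<noteq> f x \<longleftrightarrow> (x + s = u) \<noteq> (r - x = u)" for x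
  proof -
    have "flip f u (r' - (r - x)) = flip f u (r - x)"
      using fu by (simp add: reflective_def)
    moreover have "r' - (r - x) = x + s" using s(2) by (simp add: algebra_simps)
    ultimately show ?thesis by (auto simp: flip_apply f')
  qed
  \<comment> \<open>Otherwise the two changes coincide and cancel, leaving \<open>f\<close>
    periodic.\<close>
  have 1: "u + u \<noteq> r + s"
  proof
    assume "u + u = r + s"
    then have "x + s = u \<longleftrightarrow> r - x = u" for x
      by (metis add.commute add_diff_cancel_left' add_diff_cancel_right' diff_add_eq diff_eq_eq)
    then show False using ch np(1) by (auto simp: periodic_def)
  qed
  have ch': "f (x + s) \<noteq> f x \<longleftrightarrow> x = r - u \<or> x = u - s" for x
  proof -
    have "x + s = u \<longleftrightarrow> x = u - s" "r - x = u \<longleftrightarrow> x = r - u" by (auto simp: algebra_simps)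
    moreover have "r - u \<noteq> u - s" using 1 by (auto simp: algebra_simps)
    ultimately show ?thesis using ch[of x] by auto
  qed
  \<comment> \<open>Otherwise the changes are at \<open>u\<close> and \<open>u - s\<close>, and
    flipping \<open>u\<close> removes both.\<close>
  have 2: "u + u \<noteq> r"
  proof
    assume u: "u + u = r"
    have "flip f u (x + s) = flip f u x" for x
    proof -
      have "r - u = u" using u by auto
      then show ?thesis using ch'[of x] by (auto simp: flip_apply)
    qed
    then show False using np(2) by (auto simp: periodic_def)
  qed
  \<comment> \<open>Otherwise the changes are at \<open>u - s\<close> and \<open>u - s - s\<close>,
    and flipping \<open>u - s\<close> removes both.\<close>
  have 3: "u + u \<noteq> r + s + s"
  proof
    assume u: "u + u = r + s + s"
    have e: "r - u = u - s - s" using u by (simp add: algebra_simps)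
    have "flip f (u - s) (x + s) = flip f (u - s) x" for x
    proof -
      have "x + s = u - s \<longleftrightarrow> x = r - u" using e by (auto simp: algebra_simps)
      then show ?thesis using ch'[of x] s(1) e by (auto simp: flip_apply)
    qed
    then show False using np(2) by (auto simp: periodic_def)
  qed
  \<comment> \<open>For an involution \<open>s\<close>, a change at \<open>r - u\<close> comes with
    one at \<open>r - u + s\<close>, which would have to be \<open>u - s\<close>.\<close>
  have 4: "s + s \<noteq> 0"
  proof
    assume ss: "s + s = 0"
    have "f (r - u + s) \<noteq> f (r - u)" using ch' by blast
    moreover have "r - u + s + s = r - u" using ss by (simp add: add.assoc)
    ultimately have "r - u + s = r - u \<or> r - u + s = u - s" using ch'[of "r - u + s"] by metis
    then show False using s(1) 3 by (auto simp: algebra_simps)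
  qed
  show ?thesis
    using False s(1) ch' 1 2 3 4 unfolding step_def s_def[symmetric] by blast
qed

text \<open>Comparing the two ways around the parallelogram \<open>x\<close>, \<open>x + s\<close>, \<open>x + t\<close>, \<open>x + s + t\<close>, the
  number of color changes along its sides is even; this pairs up the changes of the two steps.\<close>

lemma two_steps:
  assumes f: "reflective f r" and u: "step f r u s" and v: "step f r v t" and "u \<noteq> v"
  shows "v = r + s - u \<or> v = u - s \<or> v = r - u"
proof -
  \<comment> \<open>The image of \<open>u\<close> under the second reflection; the changes now sit
    at \<open>r - u\<close> and \<open>r - u'\<close>, and likewise for \<open>v\<close>.\<close>
  define u' where "u' = r + s - u"
  define v' where "v' = r + t - v"
  have f': "f (r - x) = f x" for x using f by (simp add: reflective_def)
  have su: "u - s = r - u'" "u' - s = r - u" "u + u' = r + s" and sv: "v - t = r - v'" "v + v' = r + t"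
    by (auto simp: u'_def v'_def)
  have cu: "f (x + s) \<noteq> f x \<longleftrightarrow> x = r - u \<or> x = r - u'" for x
    using u by (simp add: step_def su)
  have cv: "f (x + t) \<noteq> f x \<longleftrightarrow> x = r - v \<or> x = r - v'" for x
    using v by (simp add: step_def sv)
  have du: "s \<noteq> 0" "u + u \<noteq> r" "u \<noteq> u'" "u' + u' \<noteq> r"
    using u by (auto simp: step_def u'_def algebra_simps)
  have t0: "t \<noteq> 0" using v by (simp add: step_def)
  have rinj: "r - x = r - y \<Longrightarrow> x = y" and rrefl: "x = r - y \<Longrightarrow> y = r - x" for x y
    by (auto simp: algebra_simps)
  have fu: "f u' \<noteq> f u"
  proof -
    have "r - u + s = u'" by (simp add: u'_def algebra_simps)
    then show ?thesis using cu[of "r - u"] f' by metis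
  qed
  \<comment> \<open>In the first two cases the changes along \<open>s\<close> are themselves
    \<open>t\<close> apart and could pair with each other, so the colors at \<open>u\<close> and
    \<open>u'\<close> are compared directly.\<close>
  consider "t = u' - u" | "t = u - u'" | "t \<noteq> u' - u" "t \<noteq> u - u'" by blast
  then show ?thesis
  proof cases
    case 1
    have "r - u' + t = r - u" using 1 by simp
    then have "u' = v \<or> u' = v'" using cv[of "r - u'"] fu f' rinj by metis
    moreover have "u + t = u'" using 1 by simp
    then have "v = r - u \<or> v' = r - u" using cv[of u] fu rrefl by metis
    moreover have "u' \<noteq> r - u" using du(1) by (simp add: u'_def algebra_simps)
    ultimately show ?thesis unfolding u'_def[symmetric] by auto
  next
    case 2
    have "r - u + t = r - u'" using 2 by simp
    then have "u = v'" using cv[of "r - u"] fu f' \<open>u \<noteq> v\<close> rinj by metis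
    moreover have "u' + t = u" using 2 by simp
    then have "v = r - u' \<or> v' = r - u'" using cv[of u'] fu rrefl by metis
    moreover have "u \<noteq> r - u'" using du(1) by (simp add: u'_def algebra_simps)
    ultimately show ?thesis unfolding su by auto
  next
    case 3
    have par: "((y = u \<or> y = u') \<noteq> (y - t = u \<or> y - t = u')) = ((y = v \<or> y = v') \<noteq> (y - s = v \<or> y - s = v'))" for y
    proof -
      have "f (r - y + s) \<noteq> f (r - y) \<longleftrightarrow> y = u \<or> y = u'"
        unfolding cu by auto
      moreover have "f (r - y + t) \<noteq> f (r - y) \<longleftrightarrow> y = v \<or> y = v'"
        unfolding cv by auto
      moreover have "f (r - y + t + s) \<noteq> f (r - y + t) \<longleftrightarrow> y - t = u \<or> y - t = u'"
        unfolding cu by (auto simp: algebra_simps)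
      moreover have "f (r - y + s + t) \<noteq> f (r - y + s) \<longleftrightarrow> y - s = v \<or> y - s = v'"
        unfolding cv by (auto simp: algebra_simps)
      moreover have "r - y + s + t = r - y + t + s" by (simp add: algebra_simps)
      ultimately show ?thesis by simp argo
    qed
    have "u - t \<noteq> u" "u - t \<noteq> u'" "u' - t \<noteq> u" "u' - t \<noteq> u'" using 3 t0 by (auto simp: algebra_simps)
    then have "u = v' \<or> u - s = v \<or> u - s = v'" "u' = v \<or> u' = v' \<or> u' - s = v \<or> u' - s = v'"
      using par[of u] par[of u'] du(3) \<open>u \<noteq> v\<close> by auto
    moreover have "u \<noteq> r - u" "r - u' \<noteq> u'" "r - u' \<noteq> r - u"
      using du by (auto simp: algebra_simps)
    ultimately show ?thesis
      using du(3) unfolding u'_def[symmetric] su by auto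
  qed
qed

text \<open>All orbits would have three elements; a point outside one orbit brings a fifth
  element.\<close>

lemma no_three_cycle_on_four_points:
  fixes a :: "'a::ab_group_add"
  assumes "distinct [p, q, s, w]" "a \<noteq> 0" "a + a \<noteq> 0"
    and cl: "\<And>x. x \<in> {p, q, s, w} \<Longrightarrow> x + a \<in> {p, q, s, w}"
  shows "a + a + a \<noteq> 0"
proof
  assume a3: "a + a + a = 0"
  let ?S = "{p, q, s, w}" and ?T = "{p, p + a, p + a + a}"
  have p3: "p + a + a + a = p" using a3 by (simp add: add.assoc)
  have "p \<in> ?S" by simp
  then have "p + a \<in> ?S" "p + a + a \<in> ?S" using cl by metis+
  then have T: "?T \<subseteq> ?S" by simp
  have S4: "card ?S = 4" using assms(1) by simp
  have "card ?T < 4" by (simp add: card_insert_if)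
  then have "?S \<noteq> ?T" using S4 by auto
  then obtain v where v: "v \<in> ?S" "v \<notin> ?T" using T by blast
  have va: "v + a \<in> ?S" using cl v(1) .
  have "v + a \<notin> ?T"
  proof
    assume "v + a \<in> ?T"
    then have "v + a = p + a + a + a \<or> v + a = p + a \<or> v + a = p + a + a" using p3 by auto
    then have "v \<in> ?T" by (elim disjE) (simp_all only: add_right_cancel insert_iff simp_thms)
    with v(2) show False by contradiction
  qed
  moreover have "card ?T = 3" using assms(2,3) by (auto simp: card_insert_if add.assoc)
  moreover have "v \<noteq> v + a" using assms(2) by simp
  ultimately have "card (insert v (insert (v + a) ?T)) = 5" using v(2) by (subst card_insert_disjoint) auto
  moreover have "insert v (insert (v + a) ?T) \<subseteq> ?S" using T v(1) va by blast
  ultimately show False using card_mono[of ?S "insert v (insert (v + a) ?T)"] S4 by simp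
qed

text \<open>Flipping \<open>z\<close> toggles the changes at \<open>z\<close> and
  \<open>z - s\<close>; later periods are found by cancelling changes this way.\<close>

lemma flip_change:
  assumes "(s::'a::ab_group_add) \<noteq> 0"
  shows "flip f z (x + s) \<noteq> flip f z x \<longleftrightarrow> (f (x + s) \<noteq> f x) \<noteq> (x = z \<or> x = z - s)"
proof -
  have "x + s = z \<longleftrightarrow> x = z - s" "z \<noteq> z - s" using assms by (auto simp: algebra_simps)
  then show ?thesis by (auto simp: flip_apply)
qed

lemma closed_pair:
  fixes a :: "'a::ab_group_add"
  assumes "p \<noteq> q" "a \<noteq> 0" "\<And>x. x \<in> {p, q} \<Longrightarrow> x + a \<in> {p, q}"
  shows "p + a = q" "a + a = 0"
proof -
  show 1: "p + a = q" using assms(2) assms(3)[of p] by auto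
  have "q + a = p" using assms(2) assms(3)[of q] by auto
  then show "a + a = 0" using 1 by (metis add.assoc add_cancel_left_right)
qed

text \<open>The changes of the twice flipped coloring along \<open>s\<close> form an
  \<open>a\<close>-invariant set of at most four points. Only \<open>r - u = u + s\<close> survives;
  \<open>not_unbreakable\<close> treats it separately.\<close>

lemma flip_step_with_small_period:
  assumes f: "reflective f r" and u: "step f r u s" and sa: "strongly_aperiodic f"
    and per: "periodic (flip (flip f u) z) a" and a: "a \<noteq> 0" "a + a = 0 \<or> a + a + a = 0"
  shows "r - u = u + s"
proof (rule ccontr)
  assume ne: "r - u \<noteq> u + s"
  define q where "q = r - u"
  define g where "g = flip (flip f u) z"
  have st: "s \<noteq> 0" "s + s \<noteq> 0" "u + u \<noteq> r" "u + u \<noteq> r + s"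
    and ch: "\<And>x. f (x + s) \<noteq> f x \<longleftrightarrow> x = q \<or> x = u - s"
    using u by (auto simp: step_def q_def)
  have fq: "f q = f u" using f by (simp add: reflective_def q_def)
  have d: "q \<noteq> u" "q \<noteq> u - s" "q \<noteq> u + s" "u \<noteq> u - s"
    using st ne by (auto simp: q_def algebra_simps)
  have gp: "g (x + a) = g x" for x using per by (simp add: periodic_def g_def)
  have ga: "g x = (f x \<noteq> ((x = u) \<noteq> (x = z)))" for x by (auto simp: g_def flip_apply)
  have zz: "z \<noteq> z - s" using st(1) by simp
  define X where "X = {x. g (x + s) \<noteq> g x}"
  have X: "x \<in> X \<longleftrightarrow> (x = u \<or> x = q) \<noteq> (x = z \<or> x = z - s)" for x
  proof -
    have "flip f u (x + s) \<noteq> flip f u x \<longleftrightarrow> x = u \<or> x = q"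
      unfolding flip_change[OF st(1)] ch using d by metis
    then show ?thesis
      unfolding X_def g_def mem_Collect_eq flip_change[OF st(1), of "flip f u"] by blast
  qed
  have cl: "x + a \<in> X" if "x \<in> X" for x
    using that gp[of x] gp[of "x + s"] unfolding X_def by (simp add: add_ac)
  have "z \<noteq> u"
  proof
    assume "z = u"
    then have "periodic f a" using per by simp
    then show False using sa a(1) by (auto simp: strongly_aperiodic_def)
  qed
  \<comment> \<open>A coincidence between \<open>{u, q}\<close> and \<open>{z, z - s}\<close> leaves
    two changes, which \<open>a\<close> must swap. Then either colors clash or \<open>f\<close>
    itself is periodic.\<close>
  then consider "z = q" | "z - s = u" | "z - s = q" "z \<noteq> q" "z - s \<noteq> u"
    | "distinct [u, q, z, z - s]" using d zz by auto
  then show False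
  proof cases
    case 1
    have ne: "u \<noteq> q - s" using d by (auto simp: algebra_simps)
    have "x \<in> X \<longleftrightarrow> x = u \<or> x = q - s" for x
      unfolding X 1 using d(1) ne zz[unfolded 1] by metis
    then have X': "X = {u, q - s}" by blast
    have c: "u + a = q - s" "a + a = 0" using closed_pair[OF ne a(1)] cl unfolding X' by blast+
    then have "u + s + a = q" by (simp add: algebra_simps)
    then have "g (u + s) = g q" using gp by metis
    moreover have "g (u + s) \<noteq> g u" using X' X_def by auto
    moreover have "g q = g u" using fq 1 d by (simp add: ga)
    ultimately show False by simp
  next
    case 2
    then have z: "z = u + s" by auto
    have ne: "q \<noteq> z" using z d by simp
    have "x \<in> X \<longleftrightarrow> x = q \<or> x = z" for x
      unfolding X 2 using d(1) ne \<open>z \<noteq> u\<close> by metis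
    then have X': "X = {q, z}" by blast
    have c: "q + a = z" "a + a = 0" using closed_pair[OF ne a(1)] cl unfolding X' by blast+
    then have "g q = g z" using gp by metis
    moreover have "u \<notin> X" using X' d \<open>z \<noteq> u\<close> by auto
    then have "g z = g u" using z by (simp add: X_def)
    moreover have "g q \<noteq> g u" using fq ne d \<open>z \<noteq> u\<close> by (simp add: ga)
    ultimately show False by simp
  next
    case 3
    have "x \<in> X \<longleftrightarrow> x = u \<or> x = z" for x
      unfolding X 3(1) using d(1) 3(2) \<open>z \<noteq> u\<close> by metis
    then have X': "X = {u, z}" by blast
    have ne: "u \<noteq> z" using \<open>z \<noteq> u\<close> by simp
    have c: "u + a = z" "a + a = 0" using closed_pair[OF ne a(1)] cl unfolding X' by blast+
    have za: "z + a = u" using c by (metis add.assoc add.right_neutral)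
    \<comment> \<open>As \<open>a\<close> exchanges the two flipped points, undoing both flips keeps
      the period.\<close>
    have "x + a = u \<longleftrightarrow> x = z" "x + a = z \<longleftrightarrow> x = u" for x
      using c(1) za by auto
    then have "f (x + a) = f x" for x
      using gp[of x] \<open>z \<noteq> u\<close> unfolding ga by auto
    then show False using sa a(1) by (auto simp: strongly_aperiodic_def periodic_def)
  next
    case 4
    have "x \<in> X \<longleftrightarrow> x = u \<or> x = q \<or> x = z \<or> x = z - s" for x
      unfolding X using 4 by (simp only: distinct.simps list.set insert_iff empty_iff) metis
    then have X': "X = {u, q, z, z - s}" by blast
    have cl': "x + a \<in> {u, q, z, z - s}" if "x \<in> {u, q, z, z - s}" for x
      using cl that unfolding X' .
    have a2: "a + a = 0"
      using no_three_cycle_on_four_points[OF 4 a(1) _ cl'] a(2) by blast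
    have inv: "x + a = y \<longleftrightarrow> y + a = x" for x y
      using a2 by (metis add.assoc add.right_neutral)
    have fx: "x + a \<noteq> x" for x using a(1) by simp
    \<comment> \<open>An involution pairs the four points in three ways: the first gives
      \<open>a = - s\<close>, the others \<open>q = u - s\<close> and
      \<open>q = u + s\<close>.\<close>
    consider "u + a = q" "z + a = z - s" | "u + a = z" "q + a = z - s" | "u + a = z - s" "q + a = z"
      using cl'[of u] cl'[of q] cl'[of z] cl'[of "z - s"] fx inv 4
      by (simp only: insert_iff empty_iff distinct.simps list.set) metis
    then show False
    proof cases
      case 1
      then have "a = - s" by (metis add_left_cancel diff_conv_add_uminus)
      then show False using a2 st(2) by (metis minus_add_distrib neg_equal_0_iff_equal)
    next
      case 2
      then have "q + a = u - s + a" by (simp add: algebra_simps)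
      then show False using d by simp
    next
      case 3
      then have "q + a = u + s + a" by (simp add: algebra_simps)
      then show False using d by simp
    qed
  qed
qed

section \<open>Removing periods of order two and three\<close>

text \<open>For larger order, a non-progression in \<open>W\<close> breaks a periodic recoloring; if
  \<open>z\<close> is outside \<open>W\<close>, two points of \<open>W\<close> forming a
  non-progression with \<open>z\<close> are used.\<close>

lemma unbreakable_small_order:
  assumes W: "card W = 4" "avoids_gaps W" and f: "unbreakable W f"
    and per: "periodic f a \<or> periodic (flip f z) a" and a: "a \<noteq> 0"
  shows "a + a = 0 \<or> a + a + a = 0"
proof (rule ccontr)
  assume "\<not> ?thesis"
  then have a': "a + a \<noteq> 0" "a + a + a \<noteq> 0" by auto
  have *: False if "unbreakable W g" "periodic g a" for g
    using exists_non_progression[OF W] periodic_not_unbreakable[OF that(2) a a'] that(1) by metis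
  show False
  proof (cases "periodic f a \<or> z \<in> W")
    case True
    then show False using * f per unbreakable_flip by metis
  next
    case False
    then show False
      using exists_non_progression_through[OF W] flip_periodic_not_unbreakable[of f z a, OF _ a a'] per f by metis
  qed
qed

text \<open>Points are recolored in the order listed. The conditions keep each partner from being
  recolored at that stage or later, so inequalities once achieved persist.\<close>

lemma four_point_recoloring:
  assumes "distinct [w1, w2, w3, w4]"
    and "x1 \<notin> {w1, w2, w3, w4}" "x2 \<notin> {w2, w3, w4}" "x3 \<notin> {w3, w4}" "x4 \<noteq> w4"
  shows "\<exists>g. (\<forall>x. x \<notin> {w1, w2, w3, w4} \<longrightarrow> g x = f x) \<and>
    g w1 \<noteq> g x1 \<and> g w2 \<noteq> g x2 \<and> g w3 \<noteq> g x3 \<and> g w4 \<noteq> (g x4 :: bool)"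
proof -
  define g1 where "g1 = f(w1 := \<not> f x1)"
  define g2 where "g2 = g1(w2 := \<not> g1 x2)"
  define g3 where "g3 = g2(w3 := \<not> g2 x3)"
  define g4 where "g4 = g3(w4 := \<not> g3 x4)"
  show ?thesis
    by (rule exI[of _ g4]) (use assms in \<open>auto simp: g1_def g2_def g3_def g4_def\<close>)
qed

lemma half_third_facts:
  "pt (1/2) + pt (1/2) = 0" "pt (1/2) \<noteq> 0" "pt (1/3) + pt (1/3) = - pt (1/3)" "pt (1/3) \<noteq> 0"
  "pt (1/2) \<noteq> pt (1/3)" "pt (1/2) \<noteq> - pt (1/3)" "pt (1/3) \<noteq> - pt (1/3)"
proof -
  have n: "z \<notin> \<int>" if "0 < z" "z < 1" for z :: real
    using that Ints_between[of z 0] by auto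
  show "pt (1/2) + pt (1/2) = 0" "pt (1/2) \<noteq> 0" "pt (1/3) + pt (1/3) = - pt (1/3)" "pt (1/3) \<noteq> 0"
    "pt (1/2) \<noteq> pt (1/3)" "pt (1/2) \<noteq> - pt (1/3)" "pt (1/3) \<noteq> - pt (1/3)"
    using n[of "1/2"] n[of "1/3"] n[of "1/6"] n[of "5/6"] n[of "2/3"] by (simp_all add: pt_simps)
qed

definition same_triangle :: "circ \<Rightarrow> circ \<Rightarrow> bool" where
  "same_triangle p q \<longleftrightarrow> p - q \<in> {0, pt (1/3), - pt (1/3)}"

lemma same_triangle_sym:
  assumes "same_triangle p q" shows "same_triangle q p"
proof -
  have "- d \<in> {0, pt (1/3), - pt (1/3)}" if "d \<in> {0, pt (1/3), - pt (1/3)}" for d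
    using that by auto
  from this[of "p - q"] show ?thesis using assms by (simp add: same_triangle_def)
qed

lemma same_triangle_trans:
  assumes "same_triangle p q" "same_triangle q s" shows "same_triangle p s"
proof -
  have "- pt (1/3) - pt (1/3) = pt (1/3)"
    using half_third_facts(3) by (metis add.inverse_inverse diff_conv_add_uminus minus_add)
  then have "d + e \<in> {0, pt (1/3), - pt (1/3)}"
    if "d \<in> {0, pt (1/3), - pt (1/3)}" "e \<in> {0, pt (1/3), - pt (1/3)}" for d e
    using that half_third_facts(3) by auto
  from this[of "p - q" "q - s"] show ?thesis using assms by (simp add: same_triangle_def)
qed

lemma same_triangle_three:
  assumes "same_triangle p q" "same_triangle p s" "same_triangle p w" "p \<noteq> q" "p \<noteq> s" "p \<noteq> w"
  shows "q = s \<or> q = w \<or> s = w"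
proof -
  have "p - q = p - s \<or> p - q = p - w \<or> p - s = p - w"
    using assms unfolding same_triangle_def by (metis empty_iff eq_iff_diff_eq_0 insert_iff)
  then show ?thesis by simp
qed

text \<open>Antipodal pairs are disjoint and \<open>same_triangle\<close> is transitive. Failure of
  all six assignments would therefore put four points in one triangle.\<close>

lemma split_into_pairs:
  fixes W :: "circ set"
  assumes "card W = 4"
  obtains p q s w where "W = {p, q, s, w}" "distinct [p, q, s, w]" "p - q \<noteq> pt (1/2)" "\<not> same_triangle s w"
proof -
  obtain x y z v where "W = {0 + pt x, 0 + pt y, 0 + pt z, 0 + pt v}"
    using rotated_coordinates[OF assms] by metis
  then obtain a b c d where W: "W = {a, b, c, d}" by blast
  then have di: "a \<noteq> b" "a \<noteq> c" "a \<noteq> d" "b \<noteq> c" "b \<noteq> d" "c \<noteq> d"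
    using assms by (auto simp: card_insert_if split: if_splits)
  have perm: "W = {a, c, b, d}" "W = {a, d, b, c}" "W = {b, c, a, d}" "W = {b, d, a, c}" "W = {c, d, a, b}"
    using W by auto
  have N: "y = z" if "x - y = pt (1/2)" "x - z = pt (1/2)" for x y z :: circ
    using that by (metis diff_diff_eq2 add_diff_cancel_left')
  have N': "y - x = pt (1/2)" if "x - y = pt (1/2)" for x y :: circ
  proof -
    have "y - x = - pt (1/2)" using that by (metis minus_diff_eq)
    then show ?thesis using half_third_facts(1) by (metis minus_unique)
  qed
  have no: "\<not> (same_triangle a b \<and> same_triangle a c \<and> same_triangle a d)"
    using same_triangle_three di by blast
  have "a - b \<noteq> pt (1/2) \<and> \<not> same_triangle c d \<or> c - d \<noteq> pt (1/2) \<and> \<not> same_triangle a b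
    \<or> a - c \<noteq> pt (1/2) \<and> \<not> same_triangle b d \<or> b - d \<noteq> pt (1/2) \<and> \<not> same_triangle a c
    \<or> a - d \<noteq> pt (1/2) \<and> \<not> same_triangle b c \<or> b - c \<noteq> pt (1/2) \<and> \<not> same_triangle a d"
  proof (rule ccontr)
    assume "\<not> ?thesis"
    then have c: "a - b = pt (1/2) \<or> same_triangle c d" "c - d = pt (1/2) \<or> same_triangle a b"
      "a - c = pt (1/2) \<or> same_triangle b d" "b - d = pt (1/2) \<or> same_triangle a c"
      "a - d = pt (1/2) \<or> same_triangle b c" "b - c = pt (1/2) \<or> same_triangle a d"
      by blast+
    have m: "\<not> (a - b = pt (1/2) \<and> a - c = pt (1/2))" "\<not> (a - b = pt (1/2) \<and> a - d = pt (1/2))"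
      "\<not> (a - c = pt (1/2) \<and> a - d = pt (1/2))" "\<not> (a - b = pt (1/2) \<and> b - c = pt (1/2))"
      "\<not> (a - b = pt (1/2) \<and> b - d = pt (1/2))" "\<not> (b - c = pt (1/2) \<and> b - d = pt (1/2))"
      "\<not> (a - c = pt (1/2) \<and> b - c = pt (1/2))" "\<not> (a - c = pt (1/2) \<and> c - d = pt (1/2))"
      "\<not> (b - c = pt (1/2) \<and> c - d = pt (1/2))" "\<not> (a - d = pt (1/2) \<and> b - d = pt (1/2))"
      "\<not> (a - d = pt (1/2) \<and> c - d = pt (1/2))" "\<not> (b - d = pt (1/2) \<and> c - d = pt (1/2))"
      using N N' di by blast+
    have sy: "same_triangle x y = same_triangle y x" for x y using same_triangle_sym by blast
    have tr: "same_triangle x y \<Longrightarrow> same_triangle y z \<Longrightarrow> same_triangle x z" for x y z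
      using same_triangle_trans by blast
    have "same_triangle a b \<and> same_triangle a c \<and> same_triangle a d"
      using c m sy[of a b] sy[of a c] sy[of a d] sy[of b c] sy[of b d] sy[of c d]
        tr[of a b c] tr[of a b d] tr[of a c b] tr[of a c d] tr[of a d b] tr[of a d c] by argo
    then show False using no by blast
  qed
  then show thesis
    using that[OF W] that[OF perm(1)] that[OF perm(2)] that[OF perm(3)] that[OF perm(4)] that[OF perm(5)] di
    by auto
qed

text \<open>Each period is violated at two disjoint places, so no single flip restores it: at
  \<open>p\<close> and \<open>q\<close> for order two, in the triangles of \<open>s\<close> and
  \<open>w\<close> for order three.\<close>

lemma exists_recoloring_without_small_periods:
  fixes W :: "circ set"
  assumes "card W = 4"
  shows "\<exists>g. (\<forall>x. x \<notin> W \<longrightarrow> g x = f x) \<and>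
    (\<forall>a. a \<noteq> 0 \<and> (a + a = 0 \<or> a + a + a = 0) \<longrightarrow> \<not> periodic g a \<and> (\<forall>z. \<not> periodic (flip g z) a))"
proof -
  let ?h = "pt (1/2)" and ?k = "pt (1/3)"
  obtain p q s w where W: "W = {p, q, s, w}" and di: "distinct [p, q, s, w]"
    and pq: "p - q \<noteq> ?h" and sw: "\<not> same_triangle s w"
    using split_into_pairs[OF assms] by metis
  have hh: "p + ?h \<noteq> p" "p + ?h \<noteq> q" "q + ?h \<noteq> q" "q + ?h \<noteq> p"
  proof -
    show "p + ?h \<noteq> p" "q + ?h \<noteq> q" using half_third_facts(2) by simp_all
    show "q + ?h \<noteq> p" using pq by auto
    show "p + ?h \<noteq> q"
    proof
      assume "p + ?h = q"
      then have "p = q - ?h" by auto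
      then have "p - q = - ?h" by simp
      then show False using pq half_third_facts(1) by (metis minus_unique)
    qed
  qed
  have tr: "same_triangle x (x + ?k)" "same_triangle x (x - ?k)" for x
    by (auto simp: same_triangle_def)
  have kk: "x + ?k \<noteq> x" "x - ?k \<noteq> x" "x + ?k \<noteq> x - ?k" for x
    using half_third_facts(3,4,7) by (auto simp: algebra_simps)
  have hk: "x + ?h \<noteq> y" if "same_triangle x y" for x y
  proof -
    have "- ?h \<noteq> ?k" using half_third_facts(6) by (metis minus_minus)
    then show ?thesis
      using that half_third_facts(2,5) unfolding same_triangle_def by auto
  qed
  have ns: "s + ?k \<noteq> w" "s - ?k \<noteq> w" "w + ?k \<noteq> s" "w - ?k \<noteq> s"
    using sw tr same_triangle_sym by metis+
  have "\<exists>g s' w'. (\<forall>x. x \<notin> W \<longrightarrow> g x = f x) \<and> g p \<noteq> g (p + ?h) \<and> g q \<noteq> g (q + ?h) \<and>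
    g s \<noteq> g s' \<and> g w \<noteq> g w' \<and> s' \<in> {s + ?k, s - ?k} \<and> w' \<in> {w + ?k, w - ?k}"
  proof -
    \<comment> \<open>Partners must not be recolored afterwards. If \<open>p\<close> and
      \<open>q\<close> complete the triangle of \<open>s\<close>, then \<open>s\<close> comes last,
      and similarly for \<open>w\<close>; otherwise \<open>s\<close> and \<open>w\<close> have
      partners outside \<open>{p, q}\<close> and come first.\<close>
    consider "s + ?k \<in> {p, q}" "s - ?k \<in> {p, q}" | "w + ?k \<in> {p, q}" "w - ?k \<in> {p, q}"
      | s' w' where "s' \<in> {s + ?k, s - ?k}" "w' \<in> {w + ?k, w - ?k}" "s' \<notin> {p, q}" "w' \<notin> {p, q}"
      by blast
    then show ?thesis
    proof cases
      case 1
      then have t: "same_triangle s p" "same_triangle s q" using tr[of s] kk(3)[of s] by auto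
      have "w + ?k \<noteq> p" "w + ?k \<noteq> q" "p + ?h \<noteq> s" "q + ?h \<noteq> s"
        using t sw tr(1)[of w] hk same_triangle_sym same_triangle_trans by metis+
      then show ?thesis
        using four_point_recoloring[of w p q s "w + ?k" "p + ?h" "q + ?h" "s + ?k" f] di hh kk ns W
        by (auto simp: insert_commute)
    next
      case 2
      then have t: "same_triangle w p" "same_triangle w q" using tr[of w] kk(3)[of w] by auto
      have "s + ?k \<noteq> p" "s + ?k \<noteq> q" "p + ?h \<noteq> w" "q + ?h \<noteq> w"
        using t sw tr(1)[of s] hk same_triangle_sym same_triangle_trans by metis+
      then show ?thesis
        using four_point_recoloring[of s p q w "s + ?k" "p + ?h" "q + ?h" "w + ?k" f] di hh kk ns W
        by (auto simp: insert_commute)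
    next
      case 3
      have "\<exists>g. (\<forall>x. x \<notin> {s, w, p, q} \<longrightarrow> g x = f x) \<and>
        g s \<noteq> g s' \<and> g w \<noteq> g w' \<and> g p \<noteq> g (p + ?h) \<and> g q \<noteq> g (q + ?h)"
        using 3 di hh kk ns by (intro four_point_recoloring) auto
      moreover have "W = {s, w, p, q}" using W by auto
      ultimately show ?thesis using 3 by metis
    qed
  qed
  then obtain g s' w' where g: "\<forall>x. x \<notin> W \<longrightarrow> g x = f x" "g p \<noteq> g (p + ?h)" "g q \<noteq> g (q + ?h)"
    "g s \<noteq> g s'" "g w \<noteq> g w'" "s' \<in> {s + ?k, s - ?k}" "w' \<in> {w + ?k, w - ?k}" by blast
  have h: "\<not> periodic g ?h" "\<not> periodic (flip g z) ?h" for z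
  proof -
    show "\<not> periodic g ?h" using g(2) by (auto simp: periodic_def)
    show "\<not> periodic (flip g z) ?h"
    proof
      assume "periodic (flip g z) ?h"
      then have "flip g z (p + ?h) = flip g z p" "flip g z (q + ?h) = flip g z q"
        by (auto simp: periodic_def)
      then have "z = p \<or> z = p + ?h" "z = q \<or> z = q + ?h" using g(2,3) by (auto simp: flip_apply)
      then show False using hh di by auto
    qed
  qed
  have k: "\<not> periodic g a" "\<not> periodic (flip g z) a" if "a = ?k \<or> a = - ?k" for z a
  proof -
    have pa: "e s' = e s \<and> e w' = e w" if per: "periodic e a" for e :: "circ \<Rightarrow> bool"
    proof -
      have "e (x + ?k) = e x" "e (x - ?k) = e x" for x
        using \<open>a = ?k \<or> a = - ?k\<close> per periodic_diff[OF per, of x]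
        by (elim disjE; simp add: periodic_def)+
      then show ?thesis using g(6,7) by (metis empty_iff insert_iff)
    qed
    show "\<not> periodic g a" using pa[of g] g(4) by auto
    show "\<not> periodic (flip g z) a"
    proof
      assume "periodic (flip g z) a"
      then have "z = s \<or> z = s'" "z = w \<or> z = w'" using pa[of "flip g z"] g(4,5) by (auto simp: flip_apply)
      moreover have "same_triangle s s'" "same_triangle w w'" using g(6,7) tr by auto
      moreover have "same_triangle x x" for x by (simp add: same_triangle_def)
      ultimately have "same_triangle s w" using same_triangle_sym same_triangle_trans by metis
      then show False using sw by blast
    qed
  qed
  show ?thesis
  proof (intro exI[of _ g] conjI allI impI)
    fix a :: circ
    assume "a \<noteq> 0 \<and> (a + a = 0 \<or> a + a + a = 0)"
    then have "a = ?h \<or> a = ?k \<or> a = - ?k" using half_unique third_unique by blast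
    then show "\<not> periodic g a" "\<not> periodic (flip g z) a" for z using h k by metis+
  qed (use g(1) in blast)
qed

lemma exists_strongly_aperiodic:
  assumes "card W = 4" "avoids_gaps W" "unbreakable W f"
  obtains g where "unbreakable W g" "strongly_aperiodic g"
proof -
  obtain g where g: "\<And>x. x \<notin> W \<Longrightarrow> g x = f x"
    "\<And>a z. a \<noteq> 0 \<Longrightarrow> a + a = 0 \<or> a + a + a = 0 \<Longrightarrow> \<not> periodic g a \<and> \<not> periodic (flip g z) a"
    using exists_recoloring_without_small_periods[OF assms(1), of f] by auto
  have "unbreakable W g" using unbreakable_agree[OF assms(3)] g(1) by blast
  moreover have "strongly_aperiodic g"
    using unbreakable_small_order[OF assms(1,2) \<open>unbreakable W g\<close>] g(2) unfolding strongly_aperiodic_def by blast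
  ultimately show thesis using that by blast
qed

section \<open>Confinement of the recolored points\<close>

text \<open>Strong aperiodicity of \<open>f\<close> leaves only reflections as symmetries of
  \<open>flip f w\<close>.\<close>

lemma flip_reflective_or_center:
  assumes "unbreakable W f" "strongly_aperiodic f" "reflective f r" "w \<in> W"
  shows "w + w = r \<or> (\<exists>t. step f r w t \<and> reflective (flip f w) (r + t))"
proof -
  have "\<not> rigid (flip f w)" using assms(1,4) unbreakable_flip unbreakable_not_rigid by blast
  then obtain r' where r': "reflective (flip f w) r'"
    using assms(2) by (auto simp: rigid_def strongly_aperiodic_def)
  have "r + (r' - r) = r'" by simp
  then show ?thesis
    using step_of_reflections[OF assms(3) r' assms(2)] r' by metis
qed

lemma step_confines:
  assumes "unbreakable W f" "strongly_aperiodic f" "reflective f r" "step f r u s" "w \<in> W"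
  shows "w + w = r \<or> w \<in> {u, r + s - u, u - s, r - u}"
  using flip_reflective_or_center[OF assms(1-3,5)] two_steps[OF assms(3,4), of w] by blast

lemma periodic_flip_of_step:
  assumes "s \<noteq> 0" "\<And>x. f (x + s) \<noteq> f x \<longleftrightarrow> x = z \<or> x = z - s"
  shows "periodic (flip f z) s"
  unfolding periodic_def
proof
  fix x
  show "flip f z (x + s) = flip f z x"
    using flip_change[OF assms(1), of f z x] assms(2)[of x] by blast
qed

lemma not_unbreakable:
  assumes W: "card W = 4" "avoids_gaps W"
  shows "\<not> unbreakable W e"
proof
  assume "unbreakable W e"
  then obtain f where ub: "unbreakable W f" and sa: "strongly_aperiodic f"
    using exists_strongly_aperiodic[OF W] by blast
  obtain r where r: "reflective f r"
    using unbreakable_not_rigid[OF ub] sa by (auto simp: rigid_def strongly_aperiodic_def)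
  \<comment> \<open>Among three distinct points of \<open>W\<close>, the reflection fixes at most
    two.\<close>
  obtain u where u: "u \<in> W" "u + u \<noteq> r"
    using exists_non_progression[OF W] at_most_two_halves by metis
  obtain s where st: "step f r u s" and r': "reflective (flip f u) (r + s)"
    using flip_reflective_or_center[OF ub sa r u(1)] u(2) by blast
  have s: "s \<noteq> 0" "s + s \<noteq> 0" "u + u \<noteq> r + s"
    and ch: "f (x + s) \<noteq> f x \<longleftrightarrow> x = r - u \<or> x = u - s" for x
    using st by (auto simp: step_def)
  have ub': "unbreakable W (flip f u)" using ub u(1) by (rule unbreakable_flip)
  have np: "\<not> periodic f a" "\<not> periodic (flip f z) a" if "a \<noteq> 0" for a z
    using sa that by (auto simp: strongly_aperiodic_def)
  \<comment> \<open>In the exceptional case \<open>r - u = u + s\<close>, flipping \<open>u\<close>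
    and \<open>u + s\<close> makes \<open>f\<close> \<open>s\<close>-periodic, so \<open>s\<close>
    has order three. Then the changes of \<open>f\<close> are adjacent, and one flip already makes
    \<open>f\<close> periodic.\<close>
  have sa': "strongly_aperiodic (flip f u)"
  proof (rule ccontr)
    assume "\<not> ?thesis"
    then obtain a z where a: "a \<noteq> 0" "periodic (flip (flip f u) z) a"
      using np by (auto simp: strongly_aperiodic_def)
    then have e: "r - u = u + s"
      using flip_step_with_small_period[OF r st sa a(2,1)] unbreakable_small_order[OF W ub'] by blast
    have "periodic (flip (flip f u) (u + s)) s"
    proof (rule periodic_flip_of_step[OF s(1)])
      fix x
      have "u + s \<noteq> u - s" using s(2) by (auto simp: algebra_simps)
      then show "flip f u (x + s) \<noteq> flip f u x \<longleftrightarrow> x = u + s \<or> x = u + s - s"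
        unfolding flip_change[OF s(1)] ch e using s(1) by auto
    qed
    then have "s + s + s = 0" using unbreakable_small_order[OF W ub' _ s(1)] s(2) by blast
    then have us: "u - s = u + s + s" by (simp add: algebra_simps)
    have "periodic (flip f (u + s + s)) s"
    proof (rule periodic_flip_of_step[OF s(1)])
      show "f (x + s) \<noteq> f x \<longleftrightarrow> x = u + s + s \<or> x = u + s + s - s" for x
        unfolding ch e us add_diff_cancel_right' by (rule disj_commute)
    qed
    then show False using np s(1) by blast
  qed
  \<comment> \<open>The roles of the two colorings are exchanged: flipping \<open>u\<close> again
    returns to \<open>f\<close>, with the opposite translation.\<close>
  have st': "step (flip f u) (r + s) u (- s)"
    using step_of_reflections[OF r' _ sa', of u r] r s(3) by simp
  \<comment> \<open>Both confinements hold at once, and no point is a center for both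
    \<open>r\<close> and \<open>r + s\<close>.\<close>
  have loc: "w \<in> {r - u, r + s - u} \<or> (w = u + s \<and> w + w = r) \<or> (w = u - s \<and> w + w = r + s)"
    if "w \<in> W" "w \<noteq> u" for w
  proof -
    have "w + w = r \<or> w = r + s - u \<or> w = u - s \<or> w = r - u"
      using step_confines[OF ub sa r st that(1)] that(2) by blast
    moreover have "w + w = r + s \<or> w = r - u \<or> w = u + s \<or> w = r + s - u"
      using step_confines[OF ub' sa' r' st' that(1)] that(2) by auto
    moreover have "u + s \<noteq> u - s" using s(2) by (auto simp: algebra_simps)
    ultimately show ?thesis using s(1) by auto
  qed
  have "finite W" using W(1) card.infinite by force
  then have c3: "card (W - {u}) = 3" using W(1) u(1) by simp
  have per: False if "unbreakable W g" "periodic g s" "s + s + s \<noteq> 0" for g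
    using unbreakable_small_order[OF W that(1) _ s(1)] that s(2) by blast
  show False
  proof (cases "u + s \<in> W \<and> u + s + (u + s) = r")
    \<comment> \<open>The center \<open>u + s\<close> fixes \<open>r\<close>, which turns
      \<open>r - u\<close> and \<open>r + s - u\<close> into the next two terms of the progression
      from \<open>u\<close>.\<close>
    case True
    then have rr: "r = u + s + (u + s)" by simp
    have e: "r - u = u + s + s" "r + s - u = u + s + s + s" unfolding rr by (simp_all add: algebra_simps)
    have "\<not> (u - s \<in> W \<and> u - s + (u - s) = r + s)"
    proof
      assume "u - s \<in> W \<and> u - s + (u - s) = r + s"
      then have "s + s + s + s + s = 0" unfolding rr by (simp add: algebra_simps)
      then have "s \<in> {pt (1/5), pt (2/5)} \<or> - s \<in> {pt (1/5), pt (2/5)}" using s(1) by (rule fifth_cases)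
      moreover have "s = u + s - u" "- s = u - (u + s)" by simp_all
      ultimately show False using W(2) True u(1) unfolding avoids_gaps_def by (metis insert_iff empty_iff)
    qed
    then have "W - {u} \<subseteq> {u + s, u + s + s, u + s + s + s}"
      using loc e by auto
    then have eq: "W - {u} = {u + s, u + s + s, u + s + s + s}"
      using c3 by (intro card_seteq) (auto simp: card_insert_if)
    have "u + s + s \<in> W" "u + s + s + s \<noteq> u" using eq by blast+
    then have s3: "s + s + s \<noteq> 0" by (metis add.assoc add.right_neutral)
    \<comment> \<open>Flipping \<open>u\<close>, then \<open>u + s\<close>, moves the change at
      \<open>u - s\<close> to \<open>u\<close> and on to \<open>u + s\<close>; flipping
      \<open>u + s + s\<close> cancels it against the other change.\<close>
    define g where "g = flip (flip (flip f u) (u + s)) (u + s + s)"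
    have "unbreakable W g"
      unfolding g_def using ub u(1) True \<open>u + s + s \<in> W\<close> by (intro unbreakable_flip) auto
    moreover have "periodic g s"
      unfolding g_def
    proof (rule periodic_flip_of_step[OF s(1)])
      fix x
      have "u + s + s \<noteq> u" "u + s + s \<noteq> u - s" "u + s \<noteq> u - s"
        using s(2) s3 by (auto simp: algebra_simps)
      then show "flip (flip f u) (u + s) (x + s) \<noteq> flip (flip f u) (u + s) x \<longleftrightarrow> x = u + s + s \<or> x = u + s + s - s"
        unfolding flip_change[OF s(1)] ch e using s(1) by auto
    qed
    ultimately show False using per s3 by blast
  next
    case False
    \<comment> \<open>Two places cannot hold the other three points of \<open>W\<close>, so the
      remaining center \<open>u - s\<close> must occur.\<close>
    have "\<not> W - {u} \<subseteq> {r - u, r + s - u}"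
    proof
      assume "W - {u} \<subseteq> {r - u, r + s - u}"
      then have "card (W - {u}) \<le> card {r - u, r + s - u}" by (intro card_mono) auto
      then show False using c3 by (auto simp: card_insert_if split: if_splits)
    qed
    then have y: "u - s \<in> W" "u - s + (u - s) = r + s" using loc False by blast+
    then have rr: "r = u - s + (u - s) - s" by simp
    have e: "r - u = u - s - s - s" "r + s - u = u - s - s" unfolding rr by (simp_all add: algebra_simps)
    have "W - {u} \<subseteq> {u - s, u - s - s, u - s - s - s}"
      using loc e False by auto
    then have eq: "W - {u} = {u - s, u - s - s, u - s - s - s}"
      using c3 by (intro card_seteq) (auto simp: card_insert_if)
    have "u - s - s \<in> W" "u - s - s - s \<noteq> u" using eq by blast+
    then have s3: "s + s + s \<noteq> 0" by (metis diff_diff_eq diff_zero)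
    \<comment> \<open>Now the changes are at \<open>u - s\<close> and \<open>u - s - s - s\<close>,
      and two flips suffice to bring them together and cancel them.\<close>
    define g where "g = flip (flip f (u - s)) (u - s - s)"
    have "unbreakable W g"
      unfolding g_def using ub y \<open>u - s - s \<in> W\<close> by (intro unbreakable_flip) auto
    moreover have "periodic g s"
      unfolding g_def
    proof (rule periodic_flip_of_step[OF s(1)])
      fix x
      have "u - s - s - s \<noteq> u - s"
        using s(2) by (auto simp: algebra_simps)
      then show "flip f (u - s) (x + s) \<noteq> flip f (u - s) x \<longleftrightarrow> x = u - s - s \<or> x = u - s - s - s"
        unfolding flip_change[OF s(1)] ch e using s(1) by auto
    qed
    ultimately show False using per s3 by blast
  qed
qed


section \<open>Return to colorings of real representatives\<close>

lemma pt_inj_on_circle: "inj_on pt circle"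
  by (rule inj_on_inverseI[of _ rep]) (simp add: circle_def)

lemma avoids_gaps_of_T':
  assumes "W \<subseteq> circle" "T' W"
  shows "avoids_gaps (pt ` W)"
proof -
  have key: "pt x - pt y \<noteq> pt (real i / real k)"
    if "x \<in> W" "y \<in> W" "k \<in> {4, 5}" "1 \<le> i" "i \<le> k - 1" "gcd i k = 1" for x y and i k :: nat
  proof
    assume "pt x - pt y = pt (real i / real k)"
    then have "pt x = pt (y + real i / real k)" by (simp add: pt_add[symmetric] algebra_simps)
    then have "frac x = frac (y + real i / real k)" by (metis rep_pt)
    then have "frac (y + real i / real k) = x" using that(1) assms(1) by (auto simp: circle_def)
    then have "x \<in> shift_set W (real i / real k) \<inter> W"
      using that(1,2) unfolding shift_set_def by auto
    moreover have "shift_set W (real i / real k) \<inter> W = {}"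
      using assms(2)[unfolded T'_def, rule_format, OF that(3) conjI[OF that(4) conjI[OF that(5,6)]]] .
    ultimately show False by blast
  qed
  have "gcd (2::nat) 5 = 1" by (simp add: gcd_non_0_nat)
  then have "pt x - pt y \<notin> {pt (1/4), pt (1/5), pt (2/5)}" if "x \<in> W" "y \<in> W" for x y
    using key[OF that, of 4 1] key[OF that, of 5 1] key[OF that, of 5 2] by simp
  then show ?thesis unfolding avoids_gaps_def by (simp only: ball_simps) simp
qed

lemma distinguishing_of_rigid:
  assumes "rigid g"
  shows "distinguishing (\<lambda>x. if g (pt x) then R else B)" (is "distinguishing ?c")
  unfolding distinguishing_def
proof (intro ballI impI)
  fix \<gamma> assume \<gamma>: "\<gamma> \<in> O2" and inv: "\<forall>x\<in>circle. ?c (\<gamma> x) = ?c x"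
  have inv': "g (pt (\<gamma> x)) = g (pt x)" if "x \<in> circle" for x
    using inv that by (metis color.distinct(1))
  have rc: "rep p \<in> circle" for p using rep_bounds[of p] by (simp add: circle_def)
  have pf: "pt (frac x) = pt x" for x by (simp add: pt_def)
  consider a where "a \<in> circle" "\<gamma> = transl a" | a where "\<gamma> = refl a"
    using \<gamma> unfolding O2_def by blast
  then show "is_identity \<gamma>"
  proof cases
    case 1
    have "g (p + pt a) = g p" for p
      using inv'[OF rc[of p]] 1(2) by (simp add: transl_def pf pt_add[symmetric])
    then have "pt a = 0" using assms by (auto simp: rigid_def periodic_def)
    then have "a \<in> \<int>" by (simp add: pt_0 pt_eq_iff)
    then have "a = 0" using 1(1) Ints_between[of a 0] by (simp add: circle_def)
    then show ?thesis using 1(2) by (simp add: is_identity_def transl_def circle_def)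
  next
    case 2
    have "g (pt (2 * a) - p) = g p" for p
      using inv'[OF rc[of p]] 2 by (simp add: refl_def pf pt_diff[symmetric])
    then show ?thesis using assms by (auto simp: rigid_def reflective_def)
  qed
qed

theorem theorem2p3p1:
  fixes W :: "real set"
  assumes "W \<subseteq> circle" and "card W = 4" and "T' W"
  shows "P W"
  unfolding P_def
proof
  fix c0 :: "real \<Rightarrow> color"
  have "card (pt ` W) = 4"
    using assms(1,2) inj_on_subset[OF pt_inj_on_circle] by (simp add: card_image)
  then have "\<not> unbreakable (pt ` W) (\<lambda>p. c0 (rep p) = R)"
    using avoids_gaps_of_T'[OF assms(1,3)] by (rule not_unbreakable)
  then obtain g where g: "rigid g" "\<And>p. p \<notin> pt ` W \<Longrightarrow> g p = (c0 (rep p) = R)"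
    unfolding unbreakable_def by blast
  have "(if g (pt x) then R else B) = c0 x" if "x \<in> circle - W" for x
  proof -
    have "pt x \<notin> pt ` W" using that assms(1) inj_onD[OF pt_inj_on_circle] by blast
    moreover have "rep (pt x) = x" using that by (simp add: circle_def)
    ultimately show ?thesis using g(2)[of "pt x"] by (cases "c0 x") auto
  qed
  then show "\<exists>c. distinguishing c \<and> (\<forall>x\<in>circle - W. c x = c0 x)"
    using distinguishing_of_rigid[OF g(1)] by blast
qed

end
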